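(* Let $\Gamma=(U_1,U_2^t)$ be a bimatrix game in which player 1 has $m_1$ actions and player 2 has $m_2$ actions, with $\max\{m_1,m_2\}\ge 2$; here $U_1=(u_1^{ij})\in\mathbb{R}^{m_1\times m_2}$ and $U_2=(u_2^{ji})\in\mathbb{R}^{m_2\times m_1}$. For each $i\in\{1,\dots,m_1\}$ and $j\in\{1,\dots,m_2\}$ put $u^{ij}:=(u_1^{ij},u_2^{ji})\in\mathbb{R}^2$ (the entries of the bimatrix). (1) If $x=(x_1,x_2)$ is a fully mixed super strong Nash equilibrium of $\Gamma$ providing zero utility to both players, then all the entries $u^{ij}$ lie on one and the same straight line in $\mathbb{R}^2$ that passes through the origin and has strictly negative slope. (2) If $x=(x_1,x_2)$ is a fully mixed strong Nash equilibrium of $\Gamma$ providing zero utility to both players, then all the entries $u^{ij}$ lie on one and the same straight line in $\mathbb{R}^2$ that passes through the origin and does not have strictly positive slope (i.e. the line has negative slope, or is horizontal, or is vertical).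
   Context: In the bimatrix game $(U_1,U_2^t)$, a mixed strategy of player $i$ is a vector $x_i$ in the simplex $\Delta_i=\{x_i\in\mathbb{R}^{m_i}: x_i\ge 0,\ \sum_k x_{ik}=1\}$. At the profile $x=(x_1,x_2)$ player 1 gets $v_1(x)=x_1^tU_1x_2$ and player 2 gets $v_2(x)=x_2^tU_2x_1$. The profile is fully mixed if all components of $x_1$ and of $x_2$ are strictly positive. A profile $\bar x$ is a Nash equilibrium if no player can strictly increase her own utility by unilaterally changing her mixed strategy. For a coalition $C$ of players (a nonempty subset), a profile $\bar x$ is weakly Pareto efficient for $C$ if there is no profile $y$, with $y_i=\bar x_i$ for all $i\notin C$ and $y_i\in\Delta_i$ arbitrary for $i\in C$, such that $v_i(y)>v_i(\bar x)$ for all $i\in C$. It is strictly Pareto efficient for $C$ if there is no such $y$ with $v_i(y)\ge v_i(\bar x)$ for all $i\in C$ and strict inequality for at least one $i\in C$. A strong (respectively super strong) Nash equilibrium is a Nash equilibrium that is weakly (respectively strictly) Pareto efficient for every coalition. *)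

theory Defs
  imports "HOL-Analysis.Analysis"
begin

text \<open>The actions of the two players are indexed by the finite types \<open>'m\<close> and \<open>'n\<close>, so that
  \<open>m\<^sub>1 = CARD('m)\<close> and \<open>m\<^sub>2 = CARD('n)\<close>. In \<open>real^'n^'m\<close> the rows are indexed by \<open>'m\<close>.\<close>

datatype player = P1 | P2

type_synonym ('m, 'n) profile = "(real ^ 'm) \<times> (real ^ 'n)"

definition simplex_strategies :: "(real ^ 'k::finite) set" where
  "simplex_strategies = {x. (\<forall>k. 0 \<le> x $ k) \<and> (\<Sum>k\<in>UNIV. x $ k) = 1}"

definition legal :: "player \<Rightarrow> ('m::finite, 'n::finite) profile \<Rightarrow> bool" where
  "legal i y = (case i of P1 \<Rightarrow> fst y \<in> simplex_strategies
                        | P2 \<Rightarrow> snd y \<in> simplex_strategies)"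

definition same_strategy ::
    "player \<Rightarrow> ('m::finite, 'n::finite) profile \<Rightarrow> ('m, 'n) profile \<Rightarrow> bool" where
  "same_strategy i x y = (case i of P1 \<Rightarrow> fst x = fst y | P2 \<Rightarrow> snd x = snd y)"

definition utility ::
    "real ^ 'n ^ 'm \<Rightarrow> real ^ 'm ^ 'n \<Rightarrow> player \<Rightarrow> ('m::finite, 'n::finite) profile \<Rightarrow> real" where
  "utility U1 U2 i x = (case i of P1 \<Rightarrow> fst x \<bullet> (U1 *v snd x)
                                | P2 \<Rightarrow> snd x \<bullet> (U2 *v fst x))"

definition fully_mixed :: "('m::finite, 'n::finite) profile \<Rightarrow> bool" where
  "fully_mixed x \<longleftrightarrow> (\<forall>i. 0 < fst x $ i) \<and> (\<forall>j. 0 < snd x $ j)"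

text \<open>The profiles available to the coalition \<open>C\<close> when the other players stick to \<open>x\<close>.\<close>

definition deviations ::
    "player set \<Rightarrow> ('m::finite, 'n::finite) profile \<Rightarrow> ('m, 'n) profile set" where
  "deviations C x = {y. (\<forall>i. i \<notin> C \<longrightarrow> same_strategy i y x) \<and> (\<forall>i\<in>C. legal i y)}"

definition nash_equilibrium ::
    "real ^ 'n ^ 'm \<Rightarrow> real ^ 'm ^ 'n \<Rightarrow> ('m::finite, 'n::finite) profile \<Rightarrow> bool" where
  "nash_equilibrium U1 U2 x \<longleftrightarrow>
     (\<forall>i. legal i x) \<and>
     (\<forall>i. \<not> (\<exists>y \<in> deviations {i} x. utility U1 U2 i y > utility U1 U2 i x))"

definition weakly_pareto_efficient ::
    "real ^ 'n ^ 'm \<Rightarrow> real ^ 'm ^ 'n \<Rightarrow> player set \<Rightarrow> ('m::finite, 'n::finite) profile \<Rightarrow> bool" where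
  "weakly_pareto_efficient U1 U2 C x \<longleftrightarrow>
     \<not> (\<exists>y \<in> deviations C x. \<forall>i\<in>C. utility U1 U2 i y > utility U1 U2 i x)"

definition strictly_pareto_efficient ::
    "real ^ 'n ^ 'm \<Rightarrow> real ^ 'm ^ 'n \<Rightarrow> player set \<Rightarrow> ('m::finite, 'n::finite) profile \<Rightarrow> bool" where
  "strictly_pareto_efficient U1 U2 C x \<longleftrightarrow>
     \<not> (\<exists>y \<in> deviations C x. (\<forall>i\<in>C. utility U1 U2 i y \<ge> utility U1 U2 i x) \<and>
                             (\<exists>i\<in>C. utility U1 U2 i y > utility U1 U2 i x))"

definition strong_nash ::
    "real ^ 'n ^ 'm \<Rightarrow> real ^ 'm ^ 'n \<Rightarrow> ('m::finite, 'n::finite) profile \<Rightarrow> bool" where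
  "strong_nash U1 U2 x \<longleftrightarrow>
     nash_equilibrium U1 U2 x \<and> (\<forall>C. C \<noteq> {} \<longrightarrow> weakly_pareto_efficient U1 U2 C x)"

definition super_strong_nash ::
    "real ^ 'n ^ 'm \<Rightarrow> real ^ 'm ^ 'n \<Rightarrow> ('m::finite, 'n::finite) profile \<Rightarrow> bool" where
  "super_strong_nash U1 U2 x \<longleftrightarrow>
     nash_equilibrium U1 U2 x \<and> (\<forall>C. C \<noteq> {} \<longrightarrow> strictly_pareto_efficient U1 U2 C x)"

text \<open>The second component carries the transposed index because \<open>U2\<close> has player 2's actions
  as rows.\<close>

definition entry ::
    "real ^ 'n ^ 'm \<Rightarrow> real ^ 'm ^ 'n \<Rightarrow> 'm::finite \<Rightarrow> 'n::finite \<Rightarrow> real \<times> real" where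
  "entry U1 U2 i j = (U1 $ i $ j, U2 $ j $ i)"

text \<open>Every straight line through the origin of the plane is either some \<open>sloped_line s\<close> or
  \<open>vertical_line\<close>.\<close>

definition sloped_line :: "real \<Rightarrow> (real \<times> real) set" where
  "sloped_line s = {(a, b). b = s * a}"

definition vertical_line :: "(real \<times> real) set" where
  "vertical_line = {(a, b). a = 0}"

end

theory Submission
  imports Defs
begin

text \<open>Write \<open>A d e = d \<bullet> (U1 *v e)\<close> and \<open>B d e = e \<bullet> (U2 *v d)\<close>. A fully mixed equilibrium
  \<open>x = (x1, x2)\<close> with zero payoffs makes both players indifferent, so \<open>A d x2 = 0\<close> and
  \<open>B x1 e = 0\<close> for all \<open>d\<close>, \<open>e\<close>. Hence the payoffs at \<open>(x1 + t d, x2 + t e)\<close> are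
  \<open>t (A x1 e + t A d e)\<close> and \<open>t (B d x2 + t B d e)\<close>, and by homogeneity weak Pareto efficiency
  forbids both to be positive for small \<open>t > 0\<close>. The first order terms give that \<open>A x1\<close> or
  \<open>B _ x2\<close> vanishes; if only one of them does, then \<open>A = 0\<close> or \<open>B = 0\<close>. If both vanish,
  then \<open>A d e * B d e \<le> 0\<close> for all \<open>d\<close>, \<open>e\<close>, and two bilinear forms of opposite sign are
  proportional. Under strict efficiency a horizontal or vertical line leaves only nonpositive
  entries, and these average to \<open>0\<close> with positive weights, so they all vanish.\<close>

section \<open>Linear and bilinear forms of opposite sign\<close>

text \<open>Otherwise \<open>(a, b)\<close> would map the span of \<open>u\<close> and
  \<open>v\<close> onto the plane and reach a point with both coordinates positive.\<close>

lemma linear_opposite_sign_dependent: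
  fixes a b :: "'v::real_vector \<Rightarrow> real"
  assumes "linear a" "linear b" and sgn: "\<And>v. a v * b v \<le> 0"
  shows "a u * b v = a v * b u"
proof (rule ccontr)
  define D where "D = a u * b v - a v * b u"
  assume "a u * b v \<noteq> a v * b u"
  then have D: "D \<noteq> 0" by (simp add: D_def)
  \<comment> \<open>By Cramer's rule some combination \<open>w\<close> of \<open>u\<close> and \<open>v\<close> has \<open>a w = b w = D\<close>.\<close>
  define w where "w = (b v - a v) *\<^sub>R u + (a u - b u) *\<^sub>R v"
  have "a w = D" "b w = D"
    using assms(1,2) by (simp_all add: w_def D_def linear_add linear_diff linear_scale left_diff_distrib mult.commute)
  then have "D * D \<le> 0" using sgn[of w] by simp
  then show False using D by (auto simp: mult_le_0_iff)
qed

text \<open>Fixing one argument leaves two dependent linear forms. The ratio at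
  \<open>(d0, e0)\<close> is carried to \<open>(d, e0)\<close> by varying the first argument and
  from there to \<open>(d, e)\<close> by varying the second.\<close>

lemma bilinear_opposite_sign_proportional:
  fixes A B :: "'v::real_vector \<Rightarrow> 'w::real_vector \<Rightarrow> real"
  assumes A: "bilinear A" and B: "bilinear B" and sgn: "\<And>d e. A d e * B d e \<le> 0"
    and nz: "A d0 e0 \<noteq> 0"
  shows "\<exists>\<mu>\<le>0. \<forall>d e. B d e = \<mu> * A d e"
proof -
  define \<mu> where "\<mu> = B d0 e0 / A d0 e0"
  have right: "A d e * B d e' = A d e' * B d e" for d e e'
    using A B sgn unfolding bilinear_def by (intro linear_opposite_sign_dependent) auto
  have left: "A d e * B d' e = A d' e * B d e" for d d' e
    using A B sgn unfolding bilinear_def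
    by (intro linear_opposite_sign_dependent[of "\<lambda>d. A d e" "\<lambda>d. B d e"]) auto
  have e0: "B d e0 = \<mu> * A d e0" for d
    using left[of d0 e0 d] nz by (simp add: \<mu>_def field_simps)
  have *: "B d e = \<mu> * A d e" if "A d e0 \<noteq> 0" for d e
    using right[of d e0 e] e0[of d] that by simp
  have "B d e = \<mu> * A d e" for d e
  proof (cases "A d e0 = 0")
    case True
    \<comment> \<open>The ratio cannot be read off at \<open>(d, e0)\<close>, so \<open>d\<close> is
      shifted by \<open>d0\<close> and the identity for \<open>d0\<close> is subtracted.\<close>
    then have "A (d0 + d) e0 \<noteq> 0" using nz by (simp add: bilinear_ladd[OF A])
    from *[OF this, of e] *[OF nz, of e] show ?thesis
      by (simp add: bilinear_ladd[OF A] bilinear_ladd[OF B] algebra_simps)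
  qed (use * in simp)
  moreover have "\<mu> \<le> 0"
    using sgn[of d0 e0] by (auto simp: \<mu>_def divide_le_0_iff mult_le_0_iff)
  ultimately show ?thesis by blast
qed

section \<open>First and second order terms of small perturbations\<close>

lemma eventually_affine_pos:
  fixes a b :: real
  assumes "a > 0"
  shows "\<forall>\<^sub>F t in at_right 0. a + t * b > 0"
proof -
  have "((\<lambda>t. a + t * b) \<longlongrightarrow> a + 0 * b) (at_right 0)"
    by (intro tendsto_intros)
  then show ?thesis using assms by (intro order_tendstoD) auto
qed

text \<open>With \<open>A x1\<close> zero, \<open>A d e > 0\<close> makes the first quantity in
  \<open>eff\<close> positive for every \<open>t > 0\<close>, so \<open>B d x2\<close> must not be
  positive. Reversing \<open>d\<close> changes both signs and reversing \<open>e\<close> only that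
  of \<open>A d e\<close>, hence \<open>A d e * B d x2 = 0\<close>.\<close>

lemma bilinear_first_order_dichotomy:
  fixes A B :: "'v::real_vector \<Rightarrow> 'w::real_vector \<Rightarrow> real"
  assumes A: "bilinear A" and B: "bilinear B"
    and A0: "\<And>e. A x1 e = 0" and B0: "\<And>e. B x1 e = 0"
    and eff: "\<And>d e. \<forall>\<^sub>F t in at_right 0. \<not> (A x1 e + t * A d e > 0 \<and> B d x2 + t * B d e > 0)"
  shows "(\<forall>d e. A d e = 0) \<or> (\<forall>d. B d x2 = 0)"
proof -
  have pos: "B d x2 \<le> 0" if "A d e > 0" for d e
  proof (rule ccontr)
    assume "\<not> B d x2 \<le> 0"
    then have "\<forall>\<^sub>F t in at_right 0. B d x2 + t * B d e > 0"
      by (intro eventually_affine_pos) simp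
    with eff[of e d] eventually_at_right_less[of 0] have "\<forall>\<^sub>F t::real in at_right 0. False"
      by eventually_elim (use that A0 in auto)
    then show False by (simp add: trivial_limit_at_right_real)
  qed
  have le: "A d e * B d x2 \<le> 0" for d e
    using pos[of d e] pos[of "- d" e]
    by (cases "A d e" "0 :: real" rule: linorder_cases)
      (auto simp: bilinear_lneg[OF A] bilinear_lneg[OF B] mult_le_0_iff)
  have ge: "A d e * B d x2 \<ge> 0" for d e
    using le[of d "- e"] by (simp add: bilinear_rneg[OF A])
  have zero: "A d e * B d x2 = 0" for d e
    using le[of d e] ge[of d e] by simp
  show ?thesis
  proof (intro disjCI allI)
    fix d e
    assume "\<not> (\<forall>d. B d x2 = 0)"
    then obtain d' where d': "B d' x2 \<noteq> 0" by blast
    \<comment> \<open>By \<open>zero\<close>, \<open>A d' e\<close> vanishes; dependence of the two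
      forms in \<open>d\<close> spreads this to every \<open>d\<close>.\<close>
    have "A d e * B d' x2 = A d' e * B d x2"
      using A B le unfolding bilinear_def
      by (intro linear_opposite_sign_dependent[of "\<lambda>d. A d e" "\<lambda>d. B d x2"]) auto
    with zero[of d' e] d' show "A d e = 0" by auto
  qed
qed

lemma bilinear_swap: "bilinear A \<Longrightarrow> bilinear (\<lambda>x y. A y x)"
  by (simp add: bilinear_def)

text \<open>The two quantities in \<open>eff\<close> are the payoffs at
  \<open>(x1 + t d, x2 + t e)\<close> divided by \<open>t\<close>. The case \<open>B = 0\<close> is
  absorbed in the conclusion as \<open>\<mu> = 0\<close>.\<close>

lemma bilinear_efficient_cases:
  fixes A B :: "'v::real_vector \<Rightarrow> 'w::real_vector \<Rightarrow> real"
  assumes A: "bilinear A" and B: "bilinear B"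
    and Ax: "\<And>d. A d x2 = 0" and Bx: "\<And>e. B x1 e = 0"
    and eff: "\<And>d e. \<forall>\<^sub>F t in at_right 0. \<not> (A x1 e + t * A d e > 0 \<and> B d x2 + t * B d e > 0)"
  shows "(\<exists>\<mu>\<le>0. \<forall>d e. B d e = \<mu> * A d e) \<or> (\<forall>d e. A d e = 0)"
proof -
  have first_order: "\<not> (A x1 e > 0 \<and> B d x2 > 0)" for d e
  proof
    assume *: "A x1 e > 0 \<and> B d x2 > 0"
    then have "\<forall>\<^sub>F t in at_right 0. A x1 e + t * A d e > 0"
      "\<forall>\<^sub>F t in at_right 0. B d x2 + t * B d e > 0"
      by (auto intro: eventually_affine_pos)
    with eff[of e d] have "\<forall>\<^sub>F t::real in at_right 0. False"
      by eventually_elim auto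
    then show False by (simp add: trivial_limit_at_right_real)
  qed
  have "(\<forall>e. A x1 e = 0) \<or> (\<forall>d. B d x2 = 0)"
  proof (rule ccontr)
    assume "\<not> ?thesis"
    then obtain d e where "A x1 e \<noteq> 0" "B d x2 \<noteq> 0" by blast
    \<comment> \<open>One term depends on \<open>e\<close> alone and the other on \<open>d\<close>
      alone, so their signs can be chosen independently.\<close>
    with first_order[of e d] first_order[of "- e" d] first_order[of e "- d"]
      first_order[of "- e" "- d"] show False
      by (auto simp: bilinear_rneg[OF A] bilinear_lneg[OF B])
  qed
  moreover have "(\<forall>d e. A d e = 0) \<or> (\<forall>d. B d x2 = 0)" if "\<forall>e. A x1 e = 0"
    using bilinear_first_order_dichotomy[of A B x1 x2] A B that Bx eff by blast
  moreover have "(\<forall>d e. B d e = 0) \<or> (\<forall>e. A x1 e = 0)" if "\<forall>d. B d x2 = 0"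
    using bilinear_first_order_dichotomy[of "\<lambda>e d. B d e" "\<lambda>e d. A d e" x2 x1]
      bilinear_swap[OF A] bilinear_swap[OF B] that Ax eff by (simp add: conj_commute) blast
  ultimately consider "\<forall>d e. A d e = 0" | "\<forall>d e. B d e = 0"
    | "\<forall>e. A x1 e = 0" "\<forall>d. B d x2 = 0" by blast
  then show ?thesis
  proof cases
    case 2
    then have "\<forall>d e. B d e = 0 * A d e" by simp
    then show ?thesis by blast
  next
    case 3
    have "\<not> (A d e > 0 \<and> B d e > 0)" for d e
    proof
      assume *: "A d e > 0 \<and> B d e > 0"
      from eff[of e d] eventually_at_right_less[of 0] have "\<forall>\<^sub>F t::real in at_right 0. False"
        by eventually_elim (use * 3 in auto)
      then show False by (simp add: trivial_limit_at_right_real)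
    qed
    note np = this
    \<comment> \<open>Reversing \<open>d\<close> changes both signs, so the forms cannot both be
      negative either.\<close>
    have "A d e * B d e \<le> 0" for d e
      using np[of d e] np[of "- d" e]
      by (auto simp: bilinear_lneg[OF A] bilinear_lneg[OF B] mult_le_0_iff)
    then show ?thesis
      using bilinear_opposite_sign_proportional[OF A B] by blast
  qed blast
qed

section \<open>From the game to its bilinear forms\<close>

lemma bilinear_inner_matrix: "bilinear (\<lambda>d e. d \<bullet> ((M :: real^'n^'m) *v e))"
  unfolding bilinear_def
  by (auto intro!: linearI simp: matrix_vector_right_distrib inner_add_right inner_add_left
      matrix_vector_mult_scaleR)

lemma axis_in_simplex: "axis i 1 \<in> simplex_strategies"
  by (auto simp: simplex_strategies_def axis_def)

lemma weighted_sum_nonpos_eq_0: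
  fixes w f :: "'k::finite \<Rightarrow> real"
  assumes "\<And>k. w k > 0" "\<And>k. f k \<le> 0" "(\<Sum>k\<in>UNIV. w k * f k) = 0"
  shows "f k = 0"
proof -
  have "(\<Sum>k\<in>UNIV. - (w k * f k)) = 0" using assms(3) by (simp add: sum_negf)
  moreover have "- (w k * f k) \<ge> 0" for k
    using assms(1,2)[of k] by (simp add: mult_le_0_iff)
  ultimately have "- (w k * f k) = 0"
    by (subst (asm) sum_nonneg_eq_0_iff) auto
  then show ?thesis using assms(1)[of k] by simp
qed

text \<open>Pure replies bound every coordinate of \<open>M *v q\<close> by 0, while the average
  with the positive weights \<open>p\<close> is 0.\<close>

lemma best_reply_indifferent:
  fixes M :: "real^'n^'m"
  assumes "\<And>i. p $ i > 0" "p \<bullet> (M *v q) = 0"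
    and "\<And>y. y \<in> simplex_strategies \<Longrightarrow> y \<bullet> (M *v q) \<le> 0"
  shows "M *v q = 0"
proof -
  have "(M *v q) $ i \<le> 0" for i
    using assms(3)[OF axis_in_simplex[of i]] by (simp add: inner_axis')
  then have "(M *v q) $ i = 0" for i
    using assms(1,2)
    by (intro weighted_sum_nonpos_eq_0[of "\<lambda>i. p $ i" "\<lambda>i. (M *v q) $ i"])
      (auto simp: inner_vec_def)
  then show ?thesis by (simp add: vec_eq_iff)
qed

text \<open>Positive scaling preserves the signs of payoffs, so perturbation directions need not
  have coordinate sum 0.\<close>

lemma pos_vec_normalize:
  fixes p :: "real^'k"
  assumes "\<And>k. p $ k > 0"
  shows "\<exists>c>0. c *\<^sub>R p \<in> simplex_strategies"
proof -
  have s: "(\<Sum>k\<in>UNIV. p $ k) > 0" using assms by (intro sum_pos) auto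
  have "(1 / (\<Sum>k\<in>UNIV. p $ k)) *\<^sub>R p \<in> simplex_strategies"
    using s assms
    by (auto simp: simplex_strategies_def sum_divide_distrib[symmetric] less_imp_le)
  with s show ?thesis by (intro exI[of _ "1 / (\<Sum>k\<in>UNIV. p $ k)"]) auto
qed

lemma eventually_pos_vec:
  fixes p d :: "real^'k"
  assumes "\<And>k. p $ k > 0"
  shows "\<forall>\<^sub>F t in at_right 0. \<forall>k. (p + t *\<^sub>R d) $ k > 0"
  using assms by (auto intro!: eventually_all_finite eventually_affine_pos)

lemma strong_nash_forms:
  fixes U1 :: "real ^ 'n::finite ^ 'm::finite" and U2 :: "real ^ 'm ^ 'n"
  assumes mixed: "fully_mixed x" and strong: "strong_nash U1 U2 x"
    and zero: "\<And>p. utility U1 U2 p x = 0"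
  shows "(\<exists>\<mu>\<le>0. \<forall>d e. e \<bullet> (U2 *v d) = \<mu> * (d \<bullet> (U1 *v e))) \<or> (\<forall>d e. d \<bullet> (U1 *v e) = 0)"
proof -
  obtain x1 x2 where x: "x = (x1, x2)" by fastforce
  have pos: "\<And>i. x1 $ i > 0" "\<And>j. x2 $ j > 0"
    using mixed by (auto simp: x fully_mixed_def)
  have zero': "x1 \<bullet> (U1 *v x2) = 0" "x2 \<bullet> (U2 *v x1) = 0"
    using zero[of P1] zero[of P2] by (auto simp: x utility_def)
  have nash: "\<not> (utility U1 U2 i y > 0)" if "y \<in> deviations {i} x" for i y
    using strong zero that by (auto simp: strong_nash_def nash_equilibrium_def)
  have "U1 *v x2 = 0"
  proof (rule best_reply_indifferent[OF pos(1) zero'(1)])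
    fix y :: "real^'m"
    assume "y \<in> simplex_strategies"
    then have "(y, x2) \<in> deviations {P1} x"
      by (auto simp: x deviations_def legal_def same_strategy_def split: player.splits)
    from nash[OF this] show "y \<bullet> (U1 *v x2) \<le> 0" by (simp add: utility_def)
  qed
  moreover have "U2 *v x1 = 0"
  proof (rule best_reply_indifferent[OF pos(2) zero'(2)])
    fix y :: "real^'n"
    assume "y \<in> simplex_strategies"
    then have "(x1, y) \<in> deviations {P2} x"
      by (auto simp: x deviations_def legal_def same_strategy_def split: player.splits)
    from nash[OF this] show "y \<bullet> (U2 *v x1) \<le> 0" by (simp add: utility_def)
  qed
  ultimately have A0: "d \<bullet> (U1 *v x2) = 0" and B0: "e \<bullet> (U2 *v x1) = 0" for d e by auto
  have eff: "\<not> (p \<bullet> (U1 *v q) > 0 \<and> q \<bullet> (U2 *v p) > 0)"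
    if pq: "\<And>i. p $ i > 0" "\<And>j. q $ j > 0" for p q
  proof
    assume *: "p \<bullet> (U1 *v q) > 0 \<and> q \<bullet> (U2 *v p) > 0"
    obtain c c' where c: "c > 0" "c *\<^sub>R p \<in> simplex_strategies"
      and c': "c' > 0" "c' *\<^sub>R q \<in> simplex_strategies"
      using pos_vec_normalize pq by metis
    have "(c *\<^sub>R p, c' *\<^sub>R q) \<in> deviations UNIV x"
      using c c' by (auto simp: deviations_def legal_def split: player.splits)
    moreover have "\<forall>i. utility U1 U2 i (c *\<^sub>R p, c' *\<^sub>R q) > 0"
      using * c(1) c'(1)
      by (auto simp: utility_def matrix_vector_mult_scaleR split: player.splits)
    moreover have "weakly_pareto_efficient U1 U2 UNIV x"
      using strong by (auto simp: strong_nash_def)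
    ultimately show False using zero by (auto simp: weakly_pareto_efficient_def)
  qed
  show ?thesis
  proof (rule bilinear_efficient_cases[of "\<lambda>d e. d \<bullet> (U1 *v e)" "\<lambda>d e. e \<bullet> (U2 *v d)" x2 x1])
    fix d :: "real^'m" and e :: "real^'n"
    show "\<forall>\<^sub>F t in at_right 0. \<not> (x1 \<bullet> (U1 *v e) + t * (d \<bullet> (U1 *v e)) > 0 \<and>
            x2 \<bullet> (U2 *v d) + t * (e \<bullet> (U2 *v d)) > 0)"
      using eventually_pos_vec[of x1 d, OF pos(1)] eventually_pos_vec[of x2 e, OF pos(2)]
        eventually_at_right_less[of 0]
    proof eventually_elim
      case (elim t)
      \<comment> \<open>In each product, indifference removes the constant term and one of the two
        terms linear in \<open>t\<close>.\<close>
      have "(x1 + t *\<^sub>R d) \<bullet> (U1 *v (x2 + t *\<^sub>R e)) = t * (x1 \<bullet> (U1 *v e) + t * (d \<bullet> (U1 *v e)))"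
        "(x2 + t *\<^sub>R e) \<bullet> (U2 *v (x1 + t *\<^sub>R d)) = t * (x2 \<bullet> (U2 *v d) + t * (e \<bullet> (U2 *v d)))"
        using A0 B0 by (simp_all add: matrix_vector_right_distrib matrix_vector_mult_scaleR
            inner_add_left inner_add_right algebra_simps)
      with eff[of "x1 + t *\<^sub>R d" "x2 + t *\<^sub>R e"] elim show ?case
        by (simp add: zero_less_mult_iff)
    qed
  qed (use A0 B0 bilinear_inner_matrix bilinear_swap[OF bilinear_inner_matrix] in auto)
qed

section \<open>Entries of the bimatrix and strict efficiency\<close>

lemma super_strong_nash_imp_strong: "super_strong_nash U1 U2 x \<Longrightarrow> strong_nash U1 U2 x"
  unfolding super_strong_nash_def strong_nash_def weakly_pareto_efficient_def
    strictly_pareto_efficient_def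
  by (metis all_not_in_conv order_less_imp_le)

lemma inner_axis_matrix_axis:
  "axis i 1 \<bullet> ((M :: real^'n^'m) *v axis j 1) = M $ i $ j"
  by (simp add: inner_axis' matrix_vector_mult_basis column_def)

text \<open>Averaging is undone twice: over the rows with weights \<open>p\<close>, then inside each
  row with weights \<open>q\<close>.\<close>

lemma nonpos_matrix_zero_value:
  fixes M :: "real^'n^'m"
  assumes "\<And>i. p $ i > 0" "\<And>j. q $ j > 0" "\<And>i j. M $ i $ j \<le> 0" "p \<bullet> (M *v q) = 0"
  shows "M $ i $ j = 0"
proof -
  have "(M *v q) $ i \<le> 0" for i
    using assms(2,3) by (auto simp: matrix_vector_mult_def mult_le_0_iff less_imp_le intro!: sum_nonpos)
  then have "(M *v q) $ i = 0"
    using assms(1,4)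
    by (intro weighted_sum_nonpos_eq_0[of "\<lambda>i. p $ i" "\<lambda>i. (M *v q) $ i"])
      (auto simp: inner_vec_def)
  then show ?thesis
    using assms(2,3)
    by (intro weighted_sum_nonpos_eq_0[of "\<lambda>j. q $ j" "\<lambda>j. M $ i $ j"])
      (auto simp: matrix_vector_mult_def mult.commute)
qed

theorem theorem3p1:
  fixes U1 :: "real ^ 'n::finite ^ 'm::finite"
    and U2 :: "real ^ 'm ^ 'n"
    and x :: "('m, 'n) profile"
  assumes "max CARD('m) CARD('n) \<ge> 2"
  shows "(fully_mixed x \<and> super_strong_nash U1 U2 x \<and> (\<forall>p. utility U1 U2 p x = 0) \<longrightarrow>
            (\<exists>s<0. \<forall>i j. entry U1 U2 i j \<in> sloped_line s)) \<and>
         (fully_mixed x \<and> strong_nash U1 U2 x \<and> (\<forall>p. utility U1 U2 p x = 0) \<longrightarrow>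
            (\<exists>L. ((\<exists>s\<le>0. L = sloped_line s) \<or> L = vertical_line) \<and>
                 (\<forall>i j. entry U1 U2 i j \<in> L)))"
proof -
  have strong: "(\<exists>s\<le>0. \<forall>i j. U2 $ j $ i = s * U1 $ i $ j) \<or> (\<forall>i j. U1 $ i $ j = 0)"
    if "fully_mixed x" "strong_nash U1 U2 x" "\<And>p. utility U1 U2 p x = 0"
    using strong_nash_forms[OF that] by (metis inner_axis_matrix_axis)
  have super: "\<exists>s<0. \<forall>i j. U2 $ j $ i = s * U1 $ i $ j"
    if mixed: "fully_mixed x" and super: "super_strong_nash U1 U2 x"
      and zero: "\<And>p. utility U1 U2 p x = 0"
  proof -
    have pos: "\<And>i. fst x $ i > 0" "\<And>j. snd x $ j > 0"
      using mixed by (auto simp: fully_mixed_def)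
    have "strictly_pareto_efficient U1 U2 UNIV x"
      using super by (auto simp: super_strong_nash_def)
    moreover have "(axis i 1, axis j 1) \<in> deviations UNIV x" for i j
      by (auto simp: deviations_def legal_def axis_in_simplex split: player.splits)
    ultimately have eff: "\<not> ((\<forall>p. utility U1 U2 p (axis i 1, axis j 1) \<ge> 0) \<and>
        (\<exists>p. utility U1 U2 p (axis i 1, axis j 1) > 0))" for i j
      using zero unfolding strictly_pareto_efficient_def by (metis UNIV_I)
    \<comment> \<open>Since \<open>x\<close> pays zero, such an entry would let both players jointly
      improve by moving to the pure profile \<open>(i, j)\<close>.\<close>
    have pure: "\<not> (U1 $ i $ j \<ge> 0 \<and> U2 $ j $ i \<ge> 0 \<and> (U1 $ i $ j > 0 \<or> U2 $ j $ i > 0))" for i j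
    proof
      assume *: "U1 $ i $ j \<ge> 0 \<and> U2 $ j $ i \<ge> 0 \<and> (U1 $ i $ j > 0 \<or> U2 $ j $ i > 0)"
      have u: "utility U1 U2 P1 (axis i 1, axis j 1) = U1 $ i $ j"
        "utility U1 U2 P2 (axis i 1, axis j 1) = U2 $ j $ i"
        by (simp_all add: utility_def inner_axis_matrix_axis)
      have "utility U1 U2 p (axis i 1, axis j 1) \<ge> 0" for p
        using * by (cases p) (simp_all add: u)
      then have "\<not> utility U1 U2 p (axis i 1, axis j 1) > 0" for p
        using eff[of i j] by blast
      from this[of P1] this[of P2] * show False by (simp add: u)
    qed
    have "(\<exists>s<0. \<forall>i j. U2 $ j $ i = s * U1 $ i $ j) \<or> (\<forall>i j. U2 $ j $ i = 0) \<or> (\<forall>i j. U1 $ i $ j = 0)"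
      using strong[OF mixed super_strong_nash_imp_strong[OF super] zero]
    proof (elim disjE exE conjE)
      fix s :: real
      assume "s \<le> 0" and s: "\<forall>i j. U2 $ j $ i = s * U1 $ i $ j"
      then consider "s < 0" | "s = 0" by linarith
      then show ?thesis by cases (use s in auto)
    qed (intro disjI2)
    then consider "\<exists>s<0. \<forall>i j. U2 $ j $ i = s * U1 $ i $ j"
      | "\<forall>i j. U2 $ j $ i = 0" | "\<forall>i j. U1 $ i $ j = 0" by argo
    then show ?thesis
    proof cases
      case 2
      have "U1 $ i $ j \<le> 0" for i j using pure[of i j] 2[rule_format, of j i] by linarith
      then have "U1 $ i $ j = 0" for i j
        using pos zero[of P1]
        by (intro nonpos_matrix_zero_value[of "fst x" "snd x"]) (auto simp: utility_def)
      \<comment> \<open>All entries are now the origin, so any negative slope would serve.\<close>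
      with 2 show ?thesis by (intro exI[of _ "- 1"]) auto
    next
      case 3
      have "U2 $ j $ i \<le> 0" for i j using pure[of i j] 3[rule_format, of i j] by linarith
      then have "U2 $ j $ i = 0" for i j
        using pos zero[of P2]
        by (intro nonpos_matrix_zero_value[of "snd x" "fst x"]) (auto simp: utility_def)
      with 3 show ?thesis by (intro exI[of _ "- 1"]) auto
    qed blast
  qed
  show ?thesis
  proof (intro conjI impI; elim conjE)
    assume "fully_mixed x" "super_strong_nash U1 U2 x" "\<forall>p. utility U1 U2 p x = 0"
    then show "\<exists>s<0. \<forall>i j. entry U1 U2 i j \<in> sloped_line s"
      using super by (simp add: entry_def sloped_line_def)
  next
    assume "fully_mixed x" "strong_nash U1 U2 x" "\<forall>p. utility U1 U2 p x = 0"
    with strong consider s where "s \<le> 0" "\<forall>i j. entry U1 U2 i j \<in> sloped_line s"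
      | "\<forall>i j. entry U1 U2 i j \<in> vertical_line"
      unfolding entry_def sloped_line_def vertical_line_def by auto
    then show "\<exists>L. ((\<exists>s\<le>0. L = sloped_line s) \<or> L = vertical_line) \<and>
        (\<forall>i j. entry U1 U2 i j \<in> L)"
      by cases blast+
  qed
qed

end
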